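(* Let $\theta$ be a real random variable whose distribution (representing the expert's beliefs) has cdf $F$ and pdf $f$, with support contained in $[0,1]$. Let $\alpha\in[0,1]$, and let $q_\alpha\in[0,1]$ satisfy $F(q_\alpha)=\alpha$ and $f(q_\alpha)>0$, the quantile being well-defined in the sense that $q_\alpha$ is the only point $q\in[0,1]$ with $F(q)=\alpha$. Let $\xi$ be uniformly distributed on $[0,1]$ and let $d\in\{0,1\}$ be Bernoulli with $P(d=1)=\alpha$, where $\theta,\xi,d$ are mutually independent. Let $r>0$ and let $u:\mathbb{R}\to\mathbb{R}$ be a utility function with $u(0)=0$ and $u(r)>0$ (no linearity or concavity of $u$ is assumed). For a report $q\in[0,1]$, the expert receives the reward $$R(q)=\begin{cases} r\,I(\theta\in[0,\xi]) & \text{if } q<\xi,\\ r\,d & \text{if } q\ge \xi,\end{cases}$$ where $I(\cdot)$ is the indicator function. Then the optimal policy for the expert is to report the true quantile: the expected utility $v(q)=E[u(R(q))]$, as a function of $q\in[0,1]$, is uniquely maximized at $q=q_\alpha$.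
   Context: An elicitor wishes to learn the $\alpha$-quantile $q_\alpha$ of an expert's subjective distribution for an unknown quantity $\theta\in[0,1]$. The expert reports a number $q\in[0,1]$ without having observed $\theta$, $\xi$ or $d$, where $\xi$ and $d$ are generated by an outside randomization. After a single realization of $(\theta,\xi,d)$ the expert is paid the reward $R(q)$. The expert's utility of a payoff $x$ is $u(x)$, and a policy (report) is optimal if it maximizes the expected utility $E[u(R(q))]$, the expectation being taken over $\theta$ (under $F$), $\xi$ and $d$. *)

theory Defs
  imports "HOL-Probability.Probability"
begin

text \<open>
  Here \<open>t\<close>, \<open>x\<close>, \<open>b\<close> are realised values of the unknown quantity, the uniform threshold and the
  Bernoulli draw; \<open>b\<close> is a real number in \<open>{0, 1}\<close>.
\<close>

definition reward :: "real \<Rightarrow> real \<Rightarrow> real \<Rightarrow> real \<Rightarrow> real \<Rightarrow> real" where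
  "reward r q t x b = (if q < x then r * indicator {0..x} t else r * b)"

definition expected_utility ::
  "'a measure \<Rightarrow> ('a \<Rightarrow> real) \<Rightarrow> ('a \<Rightarrow> real) \<Rightarrow> ('a \<Rightarrow> real) \<Rightarrow> (real \<Rightarrow> real) \<Rightarrow> real \<Rightarrow> real \<Rightarrow> real" where
  "expected_utility M \<theta> \<xi> d u r q = (\<integral>\<omega>. u (reward r q (\<theta> \<omega>) (\<xi> \<omega>) (d \<omega>)) \<partial>M)"

end

theory Submission
  imports Defs
begin

text \<open>
  Raising the report from \<open>q\<close> to \<open>p\<close> changes the reward only when \<open>q < \<xi> \<le> p\<close>: the event
  \<open>0 \<le> \<theta> \<le> \<xi>\<close> is then replaced by the event \<open>d = 1\<close>. As \<open>\<theta> \<le> \<xi>\<close> lies between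
  \<open>\<theta> \<le> q\<close> and \<open>\<theta> \<le> p\<close>, independence bounds the gain \<open>v p - v q\<close> between
  \<open>u r (p - q) (\<alpha> - F p)\<close> and \<open>u r (p - q) (\<alpha> - F q)\<close>. Since \<open>F\<close> is monotone and takes the value
  \<open>\<alpha>\<close> only at \<open>q\<^sub>\<alpha>\<close>, it follows that \<open>v\<close> strictly increases towards \<open>q\<^sub>\<alpha>\<close> from both sides.
\<close>

text \<open>Strict maximality is read off from bounds on the increments of \<open>v\<close> rather
  than from a derivative; no probability enters here.\<close>

lemma arg_max_eq_singleton_if_sandwiched:
  fixes v F :: "real \<Rightarrow> real"
  assumes "c > 0" and "mono F" and "a \<in> {0..1}" and "F a = \<alpha>"
    and unique: "\<And>q. q \<in> {0..1} \<Longrightarrow> F q = \<alpha> \<Longrightarrow> q = a"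
    and lower: "\<And>p q. 0 \<le> q \<Longrightarrow> q \<le> p \<Longrightarrow> p \<le> 1 \<Longrightarrow> c * ((p - q) * (\<alpha> - F p)) \<le> v p - v q"
    and upper: "\<And>p q. 0 \<le> q \<Longrightarrow> q \<le> p \<Longrightarrow> p \<le> 1 \<Longrightarrow> v p - v q \<le> c * ((p - q) * (\<alpha> - F q))"
  shows "{q. is_arg_max v (\<lambda>q. q \<in> {0..1}) q} = {a}"
proof -
  have less: "v q < v a" if q: "q \<in> {0..1}" "q \<noteq> a" for q
  proof -
    \<comment> \<open>Comparing \<open>q\<close> with \<open>a\<close> directly need not be strict:
      for \<open>q < a\<close> the lower bound carries the factor \<open>\<alpha> - F a = 0\<close>.
      Stopping halfway gives a strict change between \<open>q\<close> and \<open>m\<close>, where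
      uniqueness and monotonicity fix the sign of \<open>\<alpha> - F m\<close>, and the bound 0
      between \<open>m\<close> and \<open>a\<close>.\<close>
    define m where "m = (q + a) / 2"
    have m: "m \<in> {0..1}" "m \<noteq> a" using q assms(3) by (auto simp: m_def)
    then have "F m \<noteq> \<alpha>" using unique by blast
    show ?thesis
    proof (cases "q < a")
      case True
      then have "q < m" "m < a" by (auto simp: m_def)
      moreover from this have "F m < \<alpha>"
        using monoD[OF \<open>mono F\<close>, of m a] \<open>F m \<noteq> \<alpha>\<close> assms(4) by auto
      ultimately have "0 < c * ((m - q) * (\<alpha> - F m))" using \<open>c > 0\<close> by simp
      then show ?thesis
        using lower[of q m] lower[of m a] q m assms(3,4) \<open>q < m\<close> \<open>m < a\<close> by auto
    next
      case False
      then have "a < m" "m < q" using q by (auto simp: m_def)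
      moreover from this have "\<alpha> < F m"
        using monoD[OF \<open>mono F\<close>, of a m] \<open>F m \<noteq> \<alpha>\<close> assms(4) by auto
      ultimately have "c * ((q - m) * (\<alpha> - F m)) < 0"
        using \<open>c > 0\<close> by (simp add: mult_pos_neg)
      then show ?thesis
        using upper[of m q] upper[of a m] q m assms(3,4) \<open>a < m\<close> \<open>m < q\<close> by auto
    qed
  qed
  show ?thesis
  proof (intro set_eqI iffI)
    fix q assume "q \<in> {q. is_arg_max v (\<lambda>q. q \<in> {0..1}) q}"
    then have "q \<in> {0..1}" "\<not> v q < v a" using assms(3) by (auto simp: is_arg_max_def)
    then show "q \<in> {a}" using less by blast
  next
    fix q assume "q \<in> {a}"
    moreover have "\<not> v a < v p" if "p \<in> {0..1}" for p
      using less[OF that] by (cases "p = a") auto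
    ultimately show "q \<in> {q. is_arg_max v (\<lambda>q. q \<in> {0..1}) q}"
      using assms(3) unfolding is_arg_max_def by blast
  qed
qed

lemma measure_uniform_unit_interval:
  fixes \<xi> :: "'a \<Rightarrow> real"
  assumes [measurable]: "\<xi> \<in> borel_measurable M"
    and "distr M borel \<xi> = uniform_measure lborel {0..1}" and "0 \<le> q" "q \<le> p" "p \<le> 1"
  shows "measure M {\<omega> \<in> space M. q < \<xi> \<omega> \<and> \<xi> \<omega> \<le> p} = p - q"
proof -
  have "measure M {\<omega> \<in> space M. q < \<xi> \<omega> \<and> \<xi> \<omega> \<le> p} = measure (distr M borel \<xi>) {q<..p}"
    by (subst measure_distr) (auto intro!: arg_cong[where f = "measure M"])
  also have "\<dots> = measure lborel ({0..1} \<inter> {q<..p})"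
    unfolding assms(2) by (simp add: measure_uniform_measure)
  also have "{0..1} \<inter> {q<..p} = {q<..p}" using assms(3-5) by auto
  finally show ?thesis using assms(4) by simp
qed

lemma (in prob_space) indep_vars_prob_two:
  assumes "indep_vars M' X I" "i \<in> I" "j \<in> I" "i \<noteq> j" "A \<in> sets (M' i)" "B \<in> sets (M' j)"
  shows "prob {\<omega> \<in> space M. X i \<omega> \<in> A \<and> X j \<omega> \<in> B} =
    prob {\<omega> \<in> space M. X i \<omega> \<in> A} * prob {\<omega> \<in> space M. X j \<omega> \<in> B}"
proof -
  \<comment> \<open>Since \<open>i \<noteq> j\<close>, this assigns \<open>A\<close> to
    \<open>i\<close> and \<open>B\<close> to \<open>j\<close>, and the product rule for the
    subfamily \<open>{i, j}\<close> has two factors.\<close>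
  let ?E = "\<lambda>k. if k = i then A else B"
  have "prob (\<Inter>k\<in>{i, j}. X k -` ?E k \<inter> space M) = (\<Prod>k\<in>{i, j}. prob (X k -` ?E k \<inter> space M))"
    using assms by (intro indep_varsD[OF assms(1)]) auto
  moreover have "X k -` E \<inter> space M = {\<omega> \<in> space M. X k \<omega> \<in> E}" for k E
    by auto
  moreover have "(\<Inter>k\<in>{i, j}. X k -` ?E k \<inter> space M) = {\<omega> \<in> space M. X i \<omega> \<in> A \<and> X j \<omega> \<in> B}"
    using assms(4) by auto
  ultimately show ?thesis
    using assms(4) by simp
qed

text \<open>As \<open>d\<close> is 0 or 1, the reward takes only the values 0 and \<open>r\<close>.
  The utility is therefore \<open>u r\<close> times the indicator of winning, whatever the shape of
  \<open>u\<close> between or beyond these points.\<close>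

lemma (in prob_space) expected_utility_eq_prob:
  assumes [measurable]: "\<theta> \<in> borel_measurable M" "\<xi> \<in> borel_measurable M" "d \<in> borel_measurable M"
    and d: "d \<in> space M \<rightarrow> {0, 1}" and u: "u 0 = 0"
  shows "expected_utility M \<theta> \<xi> d u r q =
    u r * prob {\<omega> \<in> space M. if q < \<xi> \<omega> then 0 \<le> \<theta> \<omega> \<and> \<theta> \<omega> \<le> \<xi> \<omega> else d \<omega> = 1}"
    (is "_ = u r * prob ?A")
proof -
  have "u (reward r q (\<theta> \<omega>) (\<xi> \<omega>) (d \<omega>)) = u r * indicator ?A \<omega>" if "\<omega> \<in> space M" for \<omega>
    using that u funcset_mem[OF d that] by (auto simp: reward_def indicator_def)
  then have "expected_utility M \<theta> \<xi> d u r q = (\<integral>\<omega>. u r * indicator ?A \<omega> \<partial>M)"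
    unfolding expected_utility_def by (intro Bochner_Integration.integral_cong) auto
  also have "\<dots> = u r * prob ?A" by simp
  finally show ?thesis .
qed

lemma (in prob_space) expected_utility_diff:
  assumes [measurable]: "\<theta> \<in> borel_measurable M" "\<xi> \<in> borel_measurable M" "d \<in> borel_measurable M"
    and "d \<in> space M \<rightarrow> {0, 1}" and "u 0 = 0" and "q \<le> p"
  shows "expected_utility M \<theta> \<xi> d u r p - expected_utility M \<theta> \<xi> d u r q =
    u r * (prob {\<omega> \<in> space M. (q < \<xi> \<omega> \<and> \<xi> \<omega> \<le> p) \<and> d \<omega> = 1} -
      prob {\<omega> \<in> space M. (q < \<xi> \<omega> \<and> \<xi> \<omega> \<le> p) \<and> 0 \<le> \<theta> \<omega> \<and> \<theta> \<omega> \<le> \<xi> \<omega>})"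
    (is "_ = u r * (prob ?D - prob ?T)")
proof -
  let ?A = "\<lambda>q. {\<omega> \<in> space M. if q < \<xi> \<omega> then 0 \<le> \<theta> \<omega> \<and> \<theta> \<omega> \<le> \<xi> \<omega> else d \<omega> = 1}"
  \<comment> \<open>The winning outcomes with \<xi> outside the interval \<open>{q<..p}\<close>:
    they are common to both reports and disjoint from \<open>?D\<close> and \<open>?T\<close>, so
    they cancel.\<close>
  let ?C = "{\<omega> \<in> space M. p < \<xi> \<omega> \<and> 0 \<le> \<theta> \<omega> \<and> \<theta> \<omega> \<le> \<xi> \<omega> \<or> \<xi> \<omega> \<le> q \<and> d \<omega> = 1}"
  have "?A p = ?C \<union> ?D" "?A q = ?C \<union> ?T" using \<open>q \<le> p\<close> by auto
  moreover have "prob (?C \<union> ?D) = prob ?C + prob ?D" "prob (?C \<union> ?T) = prob ?C + prob ?T"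
    using \<open>q \<le> p\<close> by (auto intro!: finite_measure_Union)
  ultimately show ?thesis
    using assms by (simp only: expected_utility_eq_prob) (simp add: algebra_simps)
qed

lemma (in prob_space) expected_utility_diff_bounds:
  assumes indep: "indep_vars (\<lambda>_. borel) (\<lambda>i. [\<theta>, \<xi>, d] ! i) {0, 1, 2}"
    and \<theta>: "AE \<omega> in M. 0 \<le> \<theta> \<omega>"
    and \<xi>: "distr M borel \<xi> = uniform_measure lborel {0..1}"
    and d: "d \<in> space M \<rightarrow> {0, 1}" "prob {\<omega> \<in> space M. d \<omega> = 1} = \<alpha>"
    and u: "u 0 = 0" "u r \<ge> 0" and pq: "0 \<le> q" "q \<le> p" "p \<le> 1"
  defines "F \<equiv> cdf (distr M borel \<theta>)" and "v \<equiv> expected_utility M \<theta> \<xi> d u r"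
  shows "u r * ((p - q) * (\<alpha> - F p)) \<le> v p - v q" "v p - v q \<le> u r * ((p - q) * (\<alpha> - F q))"
proof -
  let ?X = "\<lambda>i. [\<theta>, \<xi>, d] ! i"
  have "random_variable borel (?X 0)" "random_variable borel (?X 1)" "random_variable borel (?X 2)"
    using indep unfolding indep_vars_def by auto
  then have [measurable]:
    "\<theta> \<in> borel_measurable M" "\<xi> \<in> borel_measurable M" "d \<in> borel_measurable M"
    by simp_all
  let ?B = "\<lambda>\<omega>. q < \<xi> \<omega> \<and> \<xi> \<omega> \<le> p"
  let ?T = "{\<omega> \<in> space M. ?B \<omega> \<and> 0 \<le> \<theta> \<omega> \<and> \<theta> \<omega> \<le> \<xi> \<omega>}"
  have B: "prob {\<omega> \<in> space M. ?B \<omega>} = p - q"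
    using pq by (intro measure_uniform_unit_interval \<xi>) auto
  have D: "prob {\<omega> \<in> space M. ?B \<omega> \<and> d \<omega> = 1} = (p - q) * \<alpha>"
    using indep_vars_prob_two[OF indep, of 1 2 "{q<..p}" "{1}"] B d(2) by simp
  have F: "prob {\<omega> \<in> space M. ?B \<omega> \<and> \<theta> \<omega> \<le> x} = (p - q) * F x" for x
  proof -
    have "F x = prob {\<omega> \<in> space M. \<theta> \<omega> \<le> x}"
      unfolding F_def cdf_def
      by (subst measure_distr) (auto intro!: arg_cong[where f = prob])
    then show ?thesis
      using indep_vars_prob_two[OF indep, of 1 0 "{q<..p}" "{..x}"] B by simp
  qed
  have diff: "v p - v q = u r * ((p - q) * \<alpha> - prob ?T)"
    unfolding v_def D[symmetric] using d(1) u(1) pq(2) by (intro expected_utility_diff) auto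
  \<comment> \<open>The event in \<open>?T\<close> compares \<theta> with \<xi> and does not factor
    directly; putting a constant in place of \<xi> yields an event to which \<open>F\<close>
    applies.\<close>
  have "prob ?T \<le> prob {\<omega> \<in> space M. ?B \<omega> \<and> \<theta> \<omega> \<le> p}"
    by (intro finite_measure_mono) auto
  then show "u r * ((p - q) * (\<alpha> - F p)) \<le> v p - v q"
    unfolding diff F using u(2) by (intro mult_left_mono) (auto simp: algebra_simps)
  \<comment> \<open>Unlike the previous inclusion, this one holds only almost everywhere: outcomes
    with \<theta> < 0 can lie on the left but never in \<open>?T\<close>.\<close>
  have "prob {\<omega> \<in> space M. ?B \<omega> \<and> \<theta> \<omega> \<le> q} \<le> prob ?T"
    using \<theta> by (intro finite_measure_mono_AE) auto
  then show "v p - v q \<le> u r * ((p - q) * (\<alpha> - F q))"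
    unfolding diff F using u(2) by (intro mult_left_mono) (auto simp: algebra_simps)
qed

theorem theorem2:
  fixes M :: "'a measure" and \<theta> \<xi> d :: "'a \<Rightarrow> real"
    and F f u :: "real \<Rightarrow> real" and \<alpha> q\<^sub>\<alpha> r :: real
  assumes "prob_space M"
    and "distributed M lborel \<theta> (\<lambda>x. ennreal (f x))" and "\<And>x. f x \<ge> 0"
    and "F = cdf (distr M borel \<theta>)"
    and "AE \<omega> in M. \<theta> \<omega> \<in> {0..1}"
    and "\<alpha> \<in> {0..1}"
    and "q\<^sub>\<alpha> \<in> {0..1}" and "F q\<^sub>\<alpha> = \<alpha>" and "f q\<^sub>\<alpha> > 0"
    and "\<And>q. q \<in> {0..1} \<Longrightarrow> F q = \<alpha> \<Longrightarrow> q = q\<^sub>\<alpha>"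
    and "distr M borel \<xi> = uniform_measure lborel {0..1}"
    and "d \<in> space M \<rightarrow> {0, 1}" and "\<P>(\<omega> in M. d \<omega> = 1) = \<alpha>"
    and "prob_space.indep_vars M (\<lambda>_. borel) (\<lambda>i. [\<theta>, \<xi>, d] ! i) {0, 1, 2}"
    and "r > 0" and "u 0 = 0" and "u r > 0"
  shows "{q. is_arg_max (expected_utility M \<theta> \<xi> d u r) (\<lambda>q. q \<in> {0..1}) q} = {q\<^sub>\<alpha>}"
proof -
  interpret prob_space M by fact
  have \<theta>: "AE \<omega> in M. 0 \<le> \<theta> \<omega>" using assms(5) by auto
  have [measurable]: "\<theta> \<in> borel_measurable M"
    using assms(2) by (simp add: distributed_def)
  interpret D: real_distribution "distr M borel \<theta>" by simp
  \<comment> \<open>The first premise left open is \<open>u r \<ge> 0\<close>; below it follows from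
    \<open>u r > 0\<close>.\<close>
  note bounds = expected_utility_diff_bounds[where u = u and r = r, OF assms(14) \<theta> assms(11,12,13,16),
    folded assms(4)]
  show ?thesis
  proof (rule arg_max_eq_singleton_if_sandwiched[where c = "u r"])
    show "mono F" unfolding assms(4) by (intro monoI D.cdf_nondecreasing)
    show "u r * ((p - q) * (\<alpha> - F p)) \<le> expected_utility M \<theta> \<xi> d u r p - expected_utility M \<theta> \<xi> d u r q"
      if "0 \<le> q" "q \<le> p" "p \<le> 1" for p q
      using bounds(1)[OF _ that] assms(17) by simp
    show "expected_utility M \<theta> \<xi> d u r p - expected_utility M \<theta> \<xi> d u r q \<le> u r * ((p - q) * (\<alpha> - F q))"
      if "0 \<le> q" "q \<le> p" "p \<le> 1" for p q
      using bounds(2)[OF _ that] assms(17) by simp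
  qed (fact assms)+
qed

end
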